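(* Let $A$ be a residuated lattice and $(\mathcal{L}(A),\lambda)$ its reticulation. Then $A$ is a strongly co-Stone residuated lattice if and only if $\mathcal{L}(A)$ is a strongly co-Stone lattice.
   Context: A residuated lattice is an algebra $(A,\vee,\wedge,\odot,\rightarrow,0,1)$ such that $(A,\vee,\wedge,0,1)$ is a bounded lattice, $(A,\odot,1)$ is a commutative monoid, and $a\leq b\rightarrow c$ iff $a\odot b\leq c$ for all $a,b,c\in A$. Write $a^n$ for the $n$-fold $\odot$-product of $a$. A reticulation of $A$ is a pair $(\mathcal{L}(A),\lambda)$ with $\mathcal{L}(A)$ a bounded distributive lattice and $\lambda:A\to\mathcal{L}(A)$ a surjective function such that for all $a,b\in A$: $\lambda(a\odot b)=\lambda(a)\wedge\lambda(b)$; $\lambda(a\vee b)=\lambda(a)\vee\lambda(b)$; $\lambda(0)=0$, $\lambda(1)=1$; and $\lambda(a)\leq\lambda(b)$ iff $a^n\leq b$ for some integer $n\geq 1$. A reticulation exists and is unique up to isomorphism (compatible with $\lambda$). A filter of a lattice is a non-empty upward closed subset closed under $\wedge$; a filter of a residuated lattice is a non-empty upward closed subset closed under $\odot$. $\langle x\rangle$ is the filter generated by $x$. For $M$ a bounded distributive lattice or a residuated lattice, $B(M)$ is the Boolean algebra of complemented elements of $M$, and $X^{\top}=\{a\in M\mid a\vee x=1\text{ for all }x\in X\}$ for $X\subseteq M$. $M$ is strongly co-Stone iff for all $X\subseteq M$ there exists $e\in B(M)$ with $X^{\top}=\langle e\rangle$. *)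

theory Defs
  imports Main "HOL.Hull"
begin

text \<open>
  The product of a residuated lattice is written \<open>*\<close>, with \<open>1\<close> its unit; the bounds \<open>0\<close> and \<open>1\<close>
  of the lattice are \<open>bot\<close> and \<open>top\<close>. The axiom \<open>one_eq_top\<close> identifies the unit with the
  greatest element, as the signature with a single constant \<open>1\<close> does.
\<close>

class residuated_lattice = bounded_lattice + comm_monoid_mult +
  fixes residuum :: "'a \<Rightarrow> 'a \<Rightarrow> 'a"
  assumes one_eq_top: "1 = top"
    and residuation: "a \<le> residuum b c \<longleftrightarrow> a * b \<le> c"

definition reticulation ::
  "('a::residuated_lattice \<Rightarrow> 'b::{bounded_lattice, distrib_lattice}) \<Rightarrow> bool" where
  "reticulation l \<longleftrightarrow>
     surj l \<and>
     (\<forall>a b. l (a * b) = inf (l a) (l b)) \<and>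
     (\<forall>a b. l (sup a b) = sup (l a) (l b)) \<and>
     l bot = bot \<and> l top = top \<and>
     (\<forall>a b. l a \<le> l b \<longleftrightarrow> (\<exists>n\<ge>1. a ^ n \<le> b))"

definition lattice_filter :: "'a::lattice set \<Rightarrow> bool" where
  "lattice_filter F \<longleftrightarrow>
     F \<noteq> {} \<and> (\<forall>a\<in>F. \<forall>b. a \<le> b \<longrightarrow> b \<in> F) \<and> (\<forall>a\<in>F. \<forall>b\<in>F. inf a b \<in> F)"

definition residuated_filter :: "'a::residuated_lattice set \<Rightarrow> bool" where
  "residuated_filter F \<longleftrightarrow>
     F \<noteq> {} \<and> (\<forall>a\<in>F. \<forall>b. a \<le> b \<longrightarrow> b \<in> F) \<and> (\<forall>a\<in>F. \<forall>b\<in>F. a * b \<in> F)"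

definition complemented_elements :: "'a::bounded_lattice set" where
  "complemented_elements = {e. \<exists>f. sup e f = top \<and> inf e f = bot}"

definition co_annihilator :: "'a::bounded_lattice set \<Rightarrow> 'a set" where
  "co_annihilator X = {a. \<forall>x\<in>X. sup a x = top}"

text \<open>
  The two notions differ only in the kind of filter generated by \<open>e\<close>: closed under \<open>inf\<close> in the
  first case, closed under the product in the second.
\<close>

definition strongly_co_Stone_lattice ::
  "'a::{bounded_lattice, distrib_lattice} itself \<Rightarrow> bool" where
  "strongly_co_Stone_lattice M \<longleftrightarrow>
     (\<forall>X::'a set. \<exists>e\<in>complemented_elements. co_annihilator X = lattice_filter hull {e})"

definition strongly_co_Stone_residuated_lattice ::
  "'a::residuated_lattice itself \<Rightarrow> bool" where
  "strongly_co_Stone_residuated_lattice M \<longleftrightarrow>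
     (\<forall>X::'a set. \<exists>e\<in>complemented_elements. co_annihilator X = residuated_filter hull {e})"

end

theory Submission
  imports Defs
begin

text \<open>
  A reticulation reflects the top element, so co-annihilators in the residuated lattice are exactly
  the preimages of co-annihilators in the reticulation, and \<open>\<langle>e\<rangle>\<close> is the preimage of the
  principal lattice filter of \<open>l e\<close>. It remains to match complemented elements. If \<open>l e\<close> and \<open>l f\<close>
  are complements, then \<open>e\<^sup>n * f\<^sup>n = 0\<close> for some \<open>n\<close>, while \<open>e\<^sup>n \<squnion> f\<^sup>n = 1\<close> because \<open>l\<close> does
  not distinguish powers. For elements with join \<open>1\<close> the meet is the product, so
  \<open>e\<^sup>n\<close> is a complemented preimage of \<open>l e\<close>.
\<close>

lemma residuated_mult_mono:
  fixes a b c d :: "'a::residuated_lattice"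
  assumes "a \<le> b" "c \<le> d"
  shows "a * c \<le> b * d"
proof -
  \<comment> \<open>Residuation applied to \<open>y * z \<le> y * z\<close> gives
    \<open>y \<le> residuum z (y * z)\<close>; transitivity then puts \<open>x\<close> below the
    same residuum.\<close>
  have left: "x * z \<le> y * z" if "x \<le> y" for x y z :: 'a
    using that residuation order_refl order_trans by metis
  have "a * c \<le> b * c" using left assms(1) .
  also have "\<dots> \<le> b * d" using left[OF assms(2), of b] by (simp add: mult.commute)
  finally show ?thesis .
qed

lemma residuated_mult_le_inf:
  fixes a b :: "'a::residuated_lattice"
  shows "a * b \<le> inf a b"
proof -
  have "a * b \<le> a * 1" "a * b \<le> 1 * b"
    by (simp_all add: residuated_mult_mono one_eq_top del: mult_1 mult_1_right)
  then show ?thesis by simp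
qed

text \<open>Both \<open>a\<close> and \<open>b\<close> lie below
  \<open>residuum (inf a b) (a * b)\<close>, hence so does their join, which is the unit.\<close>

lemma residuated_inf_eq_mult:
  fixes a b :: "'a::residuated_lattice"
  assumes "sup a b = top"
  shows "inf a b = a * b"
proof (rule antisym)
  have "a * inf a b \<le> a * b" "b * inf a b \<le> a * b"
    using residuated_mult_mono[of a a "inf a b" b] residuated_mult_mono[of b b "inf a b" a]
    by (simp_all add: mult.commute)
  then have "sup a b \<le> residuum (inf a b) (a * b)"
    by (simp flip: residuation)
  then have "1 * inf a b \<le> a * b"
    by (simp only: assms one_eq_top residuation)
  then show "inf a b \<le> a * b" by simp
qed (rule residuated_mult_le_inf)

lemma lattice_filter_hull_singleton:
  fixes e :: "'a::lattice"
  shows "lattice_filter hull {e} = {a. e \<le> a}"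
proof (rule hull_unique)
  show "lattice_filter {a. e \<le> a}"
    by (auto simp: lattice_filter_def intro: order_trans)
qed (auto simp: lattice_filter_def)

lemma residuated_filter_power:
  assumes "residuated_filter F" "e \<in> F" "n \<ge> 1"
  shows "e ^ n \<in> F"
  using assms(3,1,2)
  by (induction n rule: dec_induct) (auto simp: residuated_filter_def)

text \<open>Exponents add under products, which gives closure. The condition on the powers is
  exactly the order clause of \<open>reticulation\<close>, so the hull becomes a preimage under
  \<open>l\<close>.\<close>

lemma residuated_filter_hull_singleton:
  fixes e :: "'a::residuated_lattice"
  shows "residuated_filter hull {e} = {a. \<exists>n\<ge>1. e ^ n \<le> a}"
proof (rule hull_unique)
  have e: "e ^ 1 \<le> e" by simp
  then show "{e} \<subseteq> {a. \<exists>n\<ge>1. e ^ n \<le> a}" by blast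
  have "\<exists>k\<ge>1. e ^ k \<le> a * b"
    if "n \<ge> 1" "e ^ n \<le> a" "m \<ge> 1" "e ^ m \<le> b" for n m a b
    using that residuated_mult_mono[of "e ^ n" a "e ^ m" b]
    by (intro exI[of _ "n + m"]) (simp add: power_add)
  then show "residuated_filter {a. \<exists>n\<ge>1. e ^ n \<le> a}"
    unfolding residuated_filter_def using e by (blast intro: order_trans)
next
  fix F assume "{e} \<subseteq> F" "residuated_filter F"
  then show "{a. \<exists>n\<ge>1. e ^ n \<le> a} \<subseteq> F"
    using residuated_filter_power[of F e] by (auto simp: residuated_filter_def)
qed

context
  fixes l :: "'a::residuated_lattice \<Rightarrow> 'b::{bounded_lattice, distrib_lattice}"
  assumes ret: "reticulation l"
begin

lemma reticulation_simps:
  "l (a * b) = inf (l a) (l b)" "l (sup a b) = sup (l a) (l b)" "l bot = bot" "l top = top"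
  using ret by (auto simp: reticulation_def)

lemma reticulation_le_iff: "l a \<le> l b \<longleftrightarrow> (\<exists>n\<ge>1. a ^ n \<le> b)"
  using ret by (simp add: reticulation_def)

lemma reticulation_surj: "surj l"
  using ret by (simp add: reticulation_def)

text \<open>The order clause turns \<open>l top \<le> l a\<close> into a bound of \<open>a\<close>
  from below by a power of the unit, which is the unit itself.\<close>

lemma reticulation_eq_top_iff: "l a = top \<longleftrightarrow> a = top"
proof
  assume "l a = top"
  then have "l top \<le> l a" by simp
  then have "top \<le> a"
    unfolding reticulation_le_iff by (auto simp flip: one_eq_top)
  then show "a = top" by (simp add: top_unique)
qed (simp add: reticulation_simps)

lemma reticulation_power: "n \<ge> 1 \<Longrightarrow> l (a ^ n) = l a"
  by (induction n rule: dec_induct) (auto simp: reticulation_simps)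

lemma reticulation_co_annihilator:
  "l a \<in> co_annihilator (l ` X) \<longleftrightarrow> a \<in> co_annihilator X"
  by (simp add: co_annihilator_def reticulation_eq_top_iff flip: reticulation_simps(2))

lemma reticulation_filter_hull: "residuated_filter hull {e} = {a. l e \<le> l a}"
  by (simp add: residuated_filter_hull_singleton reticulation_le_iff)

lemma reticulation_complemented:
  assumes "e \<in> complemented_elements"
  shows "l e \<in> complemented_elements"
proof -
  obtain f where f: "sup e f = top" "inf e f = bot"
    using assms by (auto simp: complemented_elements_def)
  \<comment> \<open>The definition lets \<open>l\<close> turn products into meets, so the meet of
    the two complements is first rewritten as a product.\<close>
  then have "e * f = bot" by (simp add: residuated_inf_eq_mult)
  then have "sup (l e) (l f) = top" "inf (l e) (l f) = bot"
    using f by (metis reticulation_simps)+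
  then show ?thesis by (auto simp: complemented_elements_def)
qed

text \<open>An arbitrary preimage of \<open>c\<close> need not be complemented: every nilpotent
  element is sent to \<open>bot\<close>. Hence the passage to a power.\<close>

lemma reticulation_complemented_lift:
  assumes "c \<in> complemented_elements"
  obtains e where "e \<in> complemented_elements" "l e = c"
proof -
  obtain d where d: "sup c d = top" "inf c d = bot"
    using assms by (auto simp: complemented_elements_def)
  obtain a b where c: "c = l a" and "d = l b"
    using reticulation_surj by (meson surjD)
  with d have ab: "sup (l a) (l b) = top" "inf (l a) (l b) = bot" by simp_all
  have "l (a * b) \<le> l bot" using ab by (simp add: reticulation_simps)
  \<comment> \<open>The order clause supplies one exponent for the whole product; commutativity
    later splits the power into \<open>a ^ n * b ^ n\<close>.\<close>
  then obtain n where n: "n \<ge> 1" "(a * b) ^ n = bot"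
    unfolding reticulation_le_iff by (auto simp: bot_unique)
  have "l (sup (a ^ n) (b ^ n)) = top"
    using n ab by (simp add: reticulation_simps reticulation_power)
  then have top: "sup (a ^ n) (b ^ n) = top" by (simp add: reticulation_eq_top_iff)
  then have "inf (a ^ n) (b ^ n) = bot"
    using n by (simp add: residuated_inf_eq_mult power_mult_distrib)
  then have "a ^ n \<in> complemented_elements"
    using top by (auto simp: complemented_elements_def)
  then show thesis using that n c reticulation_power by blast
qed

end

theorem proposition3p6:
  fixes l :: "'a::residuated_lattice \<Rightarrow> 'b::{bounded_lattice, distrib_lattice}"
  assumes "reticulation l"
  shows "strongly_co_Stone_residuated_lattice TYPE('a) \<longleftrightarrow> strongly_co_Stone_lattice TYPE('b)"
proof
  assume A: "strongly_co_Stone_residuated_lattice TYPE('a)"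
  show "strongly_co_Stone_lattice TYPE('b)"
    unfolding strongly_co_Stone_lattice_def
  proof
    fix X :: "'b set"
    \<comment> \<open>The hypothesis is applied to the preimage of \<open>X\<close>, whose image is
      \<open>X\<close> again by surjectivity.\<close>
    obtain e where e: "e \<in> complemented_elements"
      "co_annihilator (l -` X) = residuated_filter hull {e}"
      using A by (auto simp: strongly_co_Stone_residuated_lattice_def)
    have X: "l ` (l -` X) = X"
      using reticulation_surj[OF assms] by (rule surj_image_vimage_eq)
    have "l a \<in> co_annihilator X \<longleftrightarrow> l e \<le> l a" for a
      using reticulation_co_annihilator[OF assms, of a "l -` X"] e(2)
      unfolding X by (simp add: reticulation_filter_hull[OF assms])
    then have "b \<in> co_annihilator X \<longleftrightarrow> l e \<le> b" for b
      using reticulation_surj[OF assms] by (metis surjD)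
    then have "co_annihilator X = lattice_filter hull {l e}"
      by (auto simp: lattice_filter_hull_singleton)
    then show "\<exists>e\<in>complemented_elements. co_annihilator X = lattice_filter hull {e}"
      using reticulation_complemented[OF assms e(1)] by blast
  qed
next
  assume L: "strongly_co_Stone_lattice TYPE('b)"
  show "strongly_co_Stone_residuated_lattice TYPE('a)"
    unfolding strongly_co_Stone_residuated_lattice_def
  proof
    fix X :: "'a set"
    obtain c where c: "c \<in> complemented_elements"
      "co_annihilator (l ` X) = lattice_filter hull {c}"
      using L by (auto simp: strongly_co_Stone_lattice_def)
    obtain e where e: "e \<in> complemented_elements" "l e = c"
      using reticulation_complemented_lift[OF assms c(1)] .
    have "a \<in> co_annihilator X \<longleftrightarrow> l e \<le> l a" for a
      using reticulation_co_annihilator[OF assms, of a X] c(2) e(2)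
      by (simp add: lattice_filter_hull_singleton)
    then have "co_annihilator X = residuated_filter hull {e}"
      by (auto simp: reticulation_filter_hull[OF assms])
    then show "\<exists>e\<in>complemented_elements. co_annihilator X = residuated_filter hull {e}"
      using e(1) by blast
  qed
qed

end
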